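(* There exists a universal constant $c>0$ such that there are arbitrarily large Cayley graphs that do not admit any $c$-quantum ergodic orthonormal eigenbasis. That is, for every $N\in\mathbb{N}$ there is a finite group $G$ with $|G|\ge N$ and a Cayley graph on $G$ none of whose orthonormal eigenbases is $c$-quantum ergodic.
   Context: A Cayley graph on a finite group $G$ is a graph with vertex set $G$ for which there is a symmetric subset $\mathfrak{S}\subseteq G$ (i.e. $\mathfrak{S}=\mathfrak{S}^{-1}$) that generates $G$, such that $\{g,h\}\subseteq G$ is an edge if and only if $gh^{-1}\in\mathfrak{S}$. Its adjacency matrix acts on $f\colon G\to\mathbb{C}$ by $(Af)(x)=\sum_{\sigma\in\mathfrak{S}}f(\sigma x)$. Every finite set $X$ is equipped with the uniform probability measure: for $f,g\colon X\to\mathbb{C}$, $\mathbb{E}f=\mathbb{E}_{x\in X}[f(x)]=\frac1{|X|}\sum_{x\in X}f(x)$, $\langle f,g\rangle=\mathbb{E}_{x\in X}[\overline{f(x)}g(x)]$, $\|f\|_2=(\mathbb{E}[|f|^2])^{1/2}$, $\|f\|_\infty=\max_{x\in X}|f(x)|$. A set $\mathcal{B}=\{\phi_1,\dots,\phi_{|X|}\}$ of functions $X\to\mathbb{C}$ is an orthonormal basis if $\|\phi_j\|_2=1$ for all $j$ and $\langle\phi_j,\phi_k\rangle=0$ for all $j\ne k$. If $X$ is a graph, $\mathcal{B}$ is an orthonormal eigenbasis if it is an orthonormal basis consisting of eigenfunctions of the adjacency matrix. For $\varepsilon>0$, an orthonormal basis $\mathcal{B}$ of functions $\phi\colon X\to\mathbb{C}$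 is $\varepsilon$-quantum ergodic if for every $f\colon X\to\mathbb{C}$, $$\mathbb{E}_{\phi\in\mathcal{B}}\Big[\big|\,\mathbb{E}_{x\in X}\big[f(x)|\phi(x)|^2\big]-\mathbb{E}f\,\big|\Big]\le\varepsilon\|f\|_\infty.$$ *)

theory Defs
  imports Complex_Main "HOL-Algebra.Generated_Groups"
begin

definition expect :: "'a set \<Rightarrow> ('a \<Rightarrow> 'b::real_field) \<Rightarrow> 'b" where
  "expect X f = (\<Sum>x\<in>X. f x) / of_nat (card X)"

definition inner_on :: "'a set \<Rightarrow> ('a \<Rightarrow> complex) \<Rightarrow> ('a \<Rightarrow> complex) \<Rightarrow> complex" where
  "inner_on X f g = expect X (\<lambda>x. cnj (f x) * g x)"

definition norm2_on :: "'a set \<Rightarrow> ('a \<Rightarrow> complex) \<Rightarrow> real" where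
  "norm2_on X f = sqrt (expect X (\<lambda>x. (cmod (f x))\<^sup>2))"

(* Only meaningful for finite nonempty X. *)
definition sup_norm_on :: "'a set \<Rightarrow> ('a \<Rightarrow> complex) \<Rightarrow> real" where
  "sup_norm_on X f = Max ((\<lambda>x. cmod (f x)) ` X)"

(* A function X -> C is represented by its extension that is undefined off X, so that
   distinct elements of B are distinct functions on X. *)
definition orthonormal_basis :: "'a set \<Rightarrow> ('a \<Rightarrow> complex) set \<Rightarrow> bool" where
  "orthonormal_basis X B \<longleftrightarrow>
     B \<subseteq> extensional X \<and> finite B \<and> card B = card X \<and>
     (\<forall>\<phi>\<in>B. norm2_on X \<phi> = 1) \<and>
     (\<forall>\<phi>\<in>B. \<forall>\<psi>\<in>B. \<phi> \<noteq> \<psi> \<longrightarrow> inner_on X \<phi> \<psi> = 0)"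

(* A graph on the vertex set X is given by its set E of edges {x, y} with x, y in X.
   A loop at x is the edge {x}; it contributes one diagonal entry 1. *)
definition adjacency_op :: "'a set \<Rightarrow> 'a set set \<Rightarrow> ('a \<Rightarrow> complex) \<Rightarrow> 'a \<Rightarrow> complex" where
  "adjacency_op X E f x = (\<Sum>y\<in>{y \<in> X. {x, y} \<in> E}. f y)"

definition eigenfunction :: "'a set \<Rightarrow> 'a set set \<Rightarrow> ('a \<Rightarrow> complex) \<Rightarrow> bool" where
  "eigenfunction X E \<phi> \<longleftrightarrow>
     (\<exists>x\<in>X. \<phi> x \<noteq> 0) \<and> (\<exists>\<mu>. \<forall>x\<in>X. adjacency_op X E \<phi> x = \<mu> * \<phi> x)"

definition orthonormal_eigenbasis :: "'a set \<Rightarrow> 'a set set \<Rightarrow> ('a \<Rightarrow> complex) set \<Rightarrow> bool" where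
  "orthonormal_eigenbasis X E B \<longleftrightarrow>
     orthonormal_basis X B \<and> (\<forall>\<phi>\<in>B. eigenfunction X E \<phi>)"

definition quantum_ergodic :: "real \<Rightarrow> 'a set \<Rightarrow> ('a \<Rightarrow> complex) set \<Rightarrow> bool" where
  "quantum_ergodic \<epsilon> X B \<longleftrightarrow>
     (\<forall>f :: 'a \<Rightarrow> complex.
        expect B (\<lambda>\<phi>. cmod (expect X (\<lambda>x. f x * of_real ((cmod (\<phi> x))\<^sup>2)) - expect X f))
          \<le> \<epsilon> * sup_norm_on X f)"

definition cayley_edges :: "('a, 'b) monoid_scheme \<Rightarrow> 'a set \<Rightarrow> 'a set set" where
  "cayley_edges G S =
     {{g, h} | g h. g \<in> carrier G \<and> h \<in> carrier G \<and> g \<otimes>\<^bsub>G\<^esub> inv\<^bsub>G\<^esub> h \<in> S}"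

definition cayley_graph :: "('a, 'b) monoid_scheme \<Rightarrow> 'a set set \<Rightarrow> bool" where
  "cayley_graph G E \<longleftrightarrow>
     (\<exists>S. S \<subseteq> carrier G \<and> set_inv\<^bsub>G\<^esub> S = S \<and> generate G S = carrier G \<and>
          E = cayley_edges G S)"

lemma (in group) cayley_edges_iff:
  assumes S: "S \<subseteq> carrier G" "set_inv S = S"
    and gh: "g \<in> carrier G" "h \<in> carrier G"
  shows "{g, h} \<in> cayley_edges G S \<longleftrightarrow> g \<otimes> inv h \<in> S"
proof
  assume "{g, h} \<in> cayley_edges G S"
  then have "g \<otimes> inv h \<in> S \<or> h \<otimes> inv g \<in> S"
    by (auto simp: cayley_edges_def doubleton_eq_iff)
  moreover have "g \<otimes> inv h \<in> S" if "h \<otimes> inv g \<in> S"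
  proof -
    have "inv (h \<otimes> inv g) \<in> S"
      using that S(2) by (auto simp: SET_INV_def)
    then show ?thesis
      using gh by (simp add: inv_mult_group)
  qed
  ultimately show "g \<otimes> inv h \<in> S" by blast
next
  assume "g \<otimes> inv h \<in> S"
  then show "{g, h} \<in> cayley_edges G S"
    using gh by (auto simp: cayley_edges_def)
qed

lemma (in group) adjacency_op_cayley:
  assumes S: "S \<subseteq> carrier G" "set_inv S = S"
    and x: "x \<in> carrier G"
  shows "adjacency_op (carrier G) (cayley_edges G S) f x = (\<Sum>\<sigma>\<in>S. f (\<sigma> \<otimes> x))"
proof -
  have eq: "{y \<in> carrier G. {x, y} \<in> cayley_edges G S} = (\<lambda>\<sigma>. \<sigma> \<otimes> x) ` S"
  proof (intro equalityI subsetI)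
    fix y assume "y \<in> {y \<in> carrier G. {x, y} \<in> cayley_edges G S}"
    then have y: "y \<in> carrier G" and "{y, x} \<in> cayley_edges G S"
      by (auto simp: insert_commute)
    then have "y \<otimes> inv x \<in> S"
      using cayley_edges_iff[OF S y x] by simp
    moreover have "y = (y \<otimes> inv x) \<otimes> x"
      using x y by (simp add: m_assoc)
    ultimately show "y \<in> (\<lambda>\<sigma>. \<sigma> \<otimes> x) ` S" by blast
  next
    fix y assume "y \<in> (\<lambda>\<sigma>. \<sigma> \<otimes> x) ` S"
    then obtain s where s: "s \<in> S" "y = s \<otimes> x" by blast
    then have sc: "s \<in> carrier G" using S(1) by blast
    then have y: "y \<in> carrier G" using s x by simp
    have "y \<otimes> inv x = s" using s sc x by (simp add: m_assoc)
    then show "y \<in> {y \<in> carrier G. {x, y} \<in> cayley_edges G S}"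
      using cayley_edges_iff[OF S y x] s y by (simp add: insert_commute)
  qed
  have "inj_on (\<lambda>\<sigma>. \<sigma> \<otimes> x) S"
    using S(1) x by (auto intro!: inj_onI simp: subset_iff)
  then show ?thesis
    unfolding adjacency_op_def eq by (simp add: sum.reindex)
qed

end

theory Submission
  imports Defs "Jordan_Normal_Form.Determinant" "HOL-Library.Countable"
begin

text \<open>The group is the product of the affine group of the field with 7 elements and a cyclic group of
  order n. An affine map is given by the images i and j of 0 and 1. Two maps with the same cyclic
  coordinate are joined when their pairs of images are disjoint, which is a twofold blow-up of the
  Kneser graph K(7,2), and the cyclic coordinate carries an n-cycle. The lowest Kneser eigenvalue -8
  is isolated by a gap of 8 while the cycle has spectrum in [-2,2], so every eigenfunction not
  orthogonal to this part of the spectrum has the form f(i,t) + f(j,t) with f summing to zero over i.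
  These eigenfunctions make up one seventh of every eigenbasis. If the t-average of the squared
  modulus were constant in (i,j), the vectors f(i,-) would be a 6-dimensional regular simplex;
  but they lie in an eigenspace of the cycle, whose real dimension is at most 4.\<close>

section \<open>Eigenfunctions of a cycle and low-rank Gram matrices\<close>

text \<open>Maximum principle: where the modulus of \<open>h\<close> is largest, the equation gives
  \<open>cmod \<nu> * cmod (h m) \<le> 2 * cmod (h m)\<close>. This turns gaps in the Kneser
  spectrum into exact vanishing.\<close>

lemma cycle_eigenfunction_eq_0:
  fixes h :: "int \<Rightarrow> complex"
  assumes n: "n > 0" and t: "t \<in> {0..<n}"
    and eq: "\<And>t. t \<in> {0..<n} \<Longrightarrow> h ((t + 1) mod n) + h ((t - 1) mod n) = \<nu> * h t"
    and nu: "cmod \<nu> > 2"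
  shows "h t = 0"
proof -
  let ?T = "{0..<n}"
  have "Max ((\<lambda>t. cmod (h t)) ` ?T) \<in> (\<lambda>t. cmod (h t)) ` ?T"
    using t by (intro Max_in) auto
  then obtain m where m': "m \<in> ?T" "Max ((\<lambda>t. cmod (h t)) ` ?T) = cmod (h m)" by auto
  have m: "m \<in> ?T" "\<And>t. t \<in> ?T \<Longrightarrow> cmod (h t) \<le> cmod (h m)"
    using m'(1) by (auto simp flip: m'(2))
  have "cmod \<nu> * cmod (h m) = cmod (h ((m + 1) mod n) + h ((m - 1) mod n))"
    using eq[OF m(1)] by (simp add: norm_mult)
  also have "\<dots> \<le> cmod (h m) + cmod (h m)"
    using n by (intro norm_triangle_mono m) auto
  finally have "(cmod \<nu> - 2) * cmod (h m) \<le> 0" by (simp add: algebra_simps)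
  then have "cmod (h m) \<le> 0" using nu by (simp add: mult_le_0_iff)
  then show ?thesis using m(2)[OF t] by simp
qed

text \<open>One Gram-Schmidt step. If \<open>P\<close> vanishes on \<open>T\<close>, the usual
  quotient degenerates and \<open>c = 0\<close> serves instead.\<close>

lemma orthogonalize_pair:
  fixes P R :: "'a \<Rightarrow> complex"
  assumes "finite T"
  obtains c where "(\<Sum>t\<in>T. cnj (P t) * (R t - c * P t)) = 0"
proof (cases "(\<Sum>t\<in>T. cnj (P t) * P t) = 0")
  case True
  have "(\<Sum>t\<in>T. (cmod (P t))\<^sup>2) = 0"
  proof -
    have "complex_of_real (\<Sum>t\<in>T. (cmod (P t))\<^sup>2) = (\<Sum>t\<in>T. cnj (P t) * P t)"
      by (simp add: complex_norm_square mult.commute del: of_real_power)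
    then show ?thesis using True of_real_eq_0_iff by metis
  qed
  then have "\<forall>t\<in>T. P t = 0" using assms by (simp add: sum_nonneg_eq_0_iff)
  then show ?thesis using that[of 0] by simp
next
  case False
  define c where "c = (\<Sum>t\<in>T. cnj (P t) * R t) / (\<Sum>t\<in>T. cnj (P t) * P t)"
  have "(\<Sum>t\<in>T. cnj (P t) * (R t - c * P t)) =
      (\<Sum>t\<in>T. cnj (P t) * R t) - c * (\<Sum>t\<in>T. cnj (P t) * P t)"
    by (simp add: algebra_simps sum_subtractf sum_distrib_left)
  also have "\<dots> = 0" using False by (simp add: c_def)
  finally show ?thesis using that by blast
qed

text \<open>\<open>U\<close> is a Gram matrix of vectors in four real dimensions. Its trace and
  Frobenius norm are those of the 4 by 4 matrix of the sums \<open>S a b\<close>, so it suffices to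
  drop the off-diagonal squares there and apply Cauchy-Schwarz to the four diagonal entries.\<close>

lemma rank4_gram_trace_bound:
  fixes p q r s :: "'a \<Rightarrow> real"
  assumes U: "\<And>i j. i \<in> I \<Longrightarrow> j \<in> I \<Longrightarrow> U i j = p i * p j + q i * q j + r i * r j + s i * s j"
  shows "(\<Sum>i\<in>I. U i i)\<^sup>2 \<le> 4 * (\<Sum>i\<in>I. \<Sum>j\<in>I. (U i j)\<^sup>2)"
proof -
  define S where "S = (\<lambda>a b :: 'a \<Rightarrow> real. \<Sum>i\<in>I. a i * b i)"
  have sq: "(S a b)\<^sup>2 = (\<Sum>i\<in>I. \<Sum>j\<in>I. (a i * b i) * (a j * b j))" for a b
    by (simp add: S_def power2_eq_square sum_product)
  have "(\<Sum>i\<in>I. \<Sum>j\<in>I. (U i j)\<^sup>2) =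
     (S p p)\<^sup>2 + (S q q)\<^sup>2 + (S r r)\<^sup>2 + (S s s)\<^sup>2 + 2 * (S p q)\<^sup>2 + 2 * (S p r)\<^sup>2 + 2 * (S p s)\<^sup>2
     + 2 * (S q r)\<^sup>2 + 2 * (S q s)\<^sup>2 + 2 * (S r s)\<^sup>2"
    unfolding sq sum_distrib_left sum.distrib[symmetric]
    by (intro sum.cong refl) (simp add: U power2_eq_square algebra_simps)
  moreover have "(\<Sum>i\<in>I. U i i) = S p p + S q q + S r r + S s s"
    by (simp add: U S_def sum.distrib)
  moreover have "(a + b + c + d)\<^sup>2 \<le> 4 * (a\<^sup>2 + b\<^sup>2 + c\<^sup>2 + d\<^sup>2)" for a b c d :: real
    using sum_squares_ge_zero[of "a - b" "c - d"] sum_squares_ge_zero[of "a - c" "b - d"]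
      sum_squares_ge_zero[of "a - d" "b - c"]
    by (simp add: power2_eq_square algebra_simps)
  moreover have "0 \<le> (S a b)\<^sup>2" for a b by simp
  ultimately show ?thesis by (smt (verit))
qed

text \<open>Functions on a cycle with the same eigenvalue span at most two complex, hence four real, dimensions.\<close>
lemma cycle_eigenspace_trace_bound:
  fixes f :: "'i \<Rightarrow> int \<Rightarrow> complex"
  assumes n: "n > 1"
    and eq: "\<And>i t. i \<in> I \<Longrightarrow> t \<in> {0..<n} \<Longrightarrow> f i ((t + 1) mod n) + f i ((t - 1) mod n) = \<nu> * f i t"
    and U: "\<And>i j. U i j = Re (\<Sum>t\<in>{0..<n}. cnj (f i t) * f j t)"
  shows "(\<Sum>i\<in>I. U i i)\<^sup>2 \<le> 4 * (\<Sum>i\<in>I. \<Sum>j\<in>I. (U i j)\<^sup>2)"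
proof -
  let ?T = "{0..<n}"
  \<comment> \<open>The eigenvalue equation is a recurrence of order two. \<open>PR k\<close> holds
    the coefficients of the values at \<open>k\<close> and at \<open>k + 1\<close> in terms of
    \<open>f i 0\<close> and \<open>f i 1\<close>; they are the same for all
    \<open>i\<close>.\<close>
  define PR :: "nat \<Rightarrow> (complex \<times> complex) \<times> (complex \<times> complex)" where
    "PR k = rec_nat ((1, 0), (0, 1)) (\<lambda>_ ((a, b), (c, d)). ((c, d), (\<nu> * c - a, \<nu> * d - b))) k" for k
  have PR_Suc: "PR (Suc k) = (snd (PR k), (\<nu> * fst (snd (PR k)) - fst (fst (PR k)),
      \<nu> * snd (snd (PR k)) - snd (fst (PR k))))" for k
    by (simp add: PR_def split: prod.splits)
  define P where "P t = fst (fst (PR (nat t)))" for t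
  define R where "R t = snd (fst (PR (nat t)))" for t
  have rep: "f i t = f i 0 * P t + f i 1 * R t" if i: "i \<in> I" and t: "t \<in> ?T" for i t
  proof -
    have "int k + 1 < n \<Longrightarrow> f i (int k) = f i 0 * fst (fst (PR k)) + f i 1 * snd (fst (PR k)) \<and>
        f i (int k + 1) = f i 0 * fst (snd (PR k)) + f i 1 * snd (snd (PR k))" for k
    proof (induction k)
      case 0
      then show ?case by (simp add: PR_def)
    next
      case (Suc k)
      have "f i (int k + 2) = \<nu> * f i (int k + 1) - f i (int k)"
        using eq[OF i, of "int k + 1"] Suc.prems by (simp add: algebra_simps)
      then show ?case using Suc by (simp add: PR_Suc algebra_simps)
    qed
    note * = this
    show ?thesis
    proof (cases "t + 1 < n")
      case True
      then show ?thesis using *[of "nat t"] t by (simp add: P_def R_def)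
    next
      case False
      \<comment> \<open>The induction stops before the cycle wraps around, so the last point is read
        off as the second component of \<open>PR\<close> at \<open>n - 2\<close>.\<close>
      then have "t = n - 1" using t by simp
      moreover have "nat (n - 1) = Suc (nat (n - 2))" using n by simp
      ultimately show ?thesis using *[of "nat (n - 2)"] n by (simp add: PR_Suc P_def R_def)
    qed
  qed
  obtain c where c: "(\<Sum>t\<in>?T. cnj (P t) * (R t - c * P t)) = 0"
    by (rule orthogonalize_pair[of ?T P R]) auto
  \<comment> \<open>Passing from \<open>R\<close> to \<open>Q\<close> makes the Gram form diagonal;
    writing \<open>R = Q + c * P\<close> moves \<open>c\<close> into the coefficient
    \<open>\<alpha>\<close>.\<close>
  define Q where "Q t = R t - c * P t" for t
  define \<alpha> where "\<alpha> i = f i 0 + c * f i 1" for i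
  define \<beta> where "\<beta> i = f i 1" for i
  define a where "a = (\<Sum>t\<in>?T. (cmod (P t))\<^sup>2)"
  define b where "b = (\<Sum>t\<in>?T. (cmod (Q t))\<^sup>2)"
  have ab: "a \<ge> 0" "b \<ge> 0" by (auto simp: a_def b_def intro: sum_nonneg)
  have o1: "(\<Sum>t\<in>?T. cnj (P t) * Q t) = 0" using c by (simp add: Q_def)
  have o2: "(\<Sum>t\<in>?T. cnj (Q t) * P t) = 0"
    using arg_cong[OF o1, of cnj] by (simp add: mult.commute)
  have a': "(\<Sum>t\<in>?T. cnj (P t) * P t) = of_real a"
    by (simp add: a_def complex_norm_square mult.commute del: of_real_power)
  have b': "(\<Sum>t\<in>?T. cnj (Q t) * Q t) = of_real b"
    by (simp add: b_def complex_norm_square mult.commute del: of_real_power)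
  \<comment> \<open>The real part of a complex inner product pairs real with real and imaginary with
    imaginary parts, so two complex coordinates become four real ones.\<close>
  have "U i j = (sqrt a * Re (\<alpha> i)) * (sqrt a * Re (\<alpha> j)) + (sqrt a * Im (\<alpha> i)) * (sqrt a * Im (\<alpha> j))
      + (sqrt b * Re (\<beta> i)) * (sqrt b * Re (\<beta> j)) + (sqrt b * Im (\<beta> i)) * (sqrt b * Im (\<beta> j))"
    if ij: "i \<in> I" "j \<in> I" for i j
  proof -
    have r: "f i t = \<alpha> i * P t + \<beta> i * Q t" if "i \<in> I" "t \<in> ?T" for i t
      using rep[OF that] by (simp add: \<alpha>_def \<beta>_def Q_def algebra_simps)
    have "(\<Sum>t\<in>?T. cnj (f i t) * f j t) =
      cnj (\<alpha> i) * \<alpha> j * (\<Sum>t\<in>?T. cnj (P t) * P t) + cnj (\<alpha> i) * \<beta> j * (\<Sum>t\<in>?T. cnj (P t) * Q t)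
      + cnj (\<beta> i) * \<alpha> j * (\<Sum>t\<in>?T. cnj (Q t) * P t) + cnj (\<beta> i) * \<beta> j * (\<Sum>t\<in>?T. cnj (Q t) * Q t)"
      unfolding sum_distrib_left sum.distrib[symmetric]
      by (intro sum.cong refl) (simp add: r ij algebra_simps)
    also have "\<dots> = cnj (\<alpha> i) * \<alpha> j * of_real a + cnj (\<beta> i) * \<beta> j * of_real b"
      unfolding o1 o2 a' b' by simp
    finally have Uij: "U i j = a * (Re (\<alpha> i) * Re (\<alpha> j) + Im (\<alpha> i) * Im (\<alpha> j))
       + b * (Re (\<beta> i) * Re (\<beta> j) + Im (\<beta> i) * Im (\<beta> j))"
      by (simp add: U algebra_simps)
    have sa: "sqrt a * (sqrt a * x) = a * x" and sb: "sqrt b * (sqrt b * x) = b * x" for x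
      using ab by (simp_all flip: mult.assoc)
    show ?thesis by (simp add: Uij sa sb algebra_simps)
  qed
  then show ?thesis by (rule rank4_gram_trace_bound)
qed

section \<open>Separation of the Kneser eigenvalue -8\<close>

text \<open>\<open>\<psi>\<close> is an eigenfunction extended by zero to \<open>i = j\<close>. Thus
  \<open>k\<close> and \<open>l\<close> can both run over \<open>I - {i, j}\<close> in the Kneser
  sum, the terms with \<open>k = l\<close> being zero.\<close>

locale kneser_cycle_eigenfunction =
  fixes n :: int and \<psi> :: "int \<Rightarrow> int \<Rightarrow> int \<Rightarrow> complex" and \<mu> :: complex
    and I T :: "int set"
  defines "I \<equiv> {0..<7}" and "T \<equiv> {0..<n}"
  assumes n: "n > 2"
    and diag: "\<And>i t. \<psi> i i t = 0"
    and eigen: "\<And>i j t. i \<in> I \<Longrightarrow> j \<in> I \<Longrightarrow> i \<noteq> j \<Longrightarrow> t \<in> T \<Longrightarrow>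
      (\<Sum>k\<in>I - {i, j}. \<Sum>l\<in>I - {i, j}. \<psi> k l t) + (\<psi> i j ((t + 1) mod n) + \<psi> i j ((t - 1) mod n)) = \<mu> * \<psi> i j t"
begin

definition "cyc h t = h ((t + 1) mod n) + h ((t - 1) mod n)" for h :: "int \<Rightarrow> complex"
text \<open>This is the total of \<open>\<psi>\<close> over the ordered pairs containing
  \<open>i\<close>. Its mean over \<open>i\<close> is \<open>2/7 * s t\<close>, whence the centering
  below.\<close>

definition "g i t = (\<Sum>l\<in>I. \<psi> i l t + \<psi> l i t)"
definition "s t = (\<Sum>k\<in>I. \<Sum>l\<in>I. \<psi> k l t)"

lemma finite_I [simp]: "finite I" and card_I [simp]: "card I = 7"
  by (simp_all add: I_def)

lemma cyc_zero:
  assumes "\<And>t. t \<in> T \<Longrightarrow> cyc h t = \<nu> * h t" "cmod \<nu> > 2" "t \<in> T"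
  shows "h t = 0"
  using cycle_eigenfunction_eq_0[of n t h \<nu>] n assms by (simp add: cyc_def T_def)

lemma cyc_diff: "cyc (\<lambda>t. a t - b t) t = cyc a t - cyc b t"
  and cyc_add: "cyc (\<lambda>t. a t + b t) t = cyc a t + cyc b t"
  and cyc_mult: "cyc (\<lambda>t. c * a t) t = c * cyc a t"
  and cyc_sum: "cyc (\<lambda>t. \<Sum>x\<in>A. F x t) t = (\<Sum>x\<in>A. cyc (F x) t)"
  by (simp_all add: cyc_def algebra_simps sum.distrib)

lemma sum_g: "(\<Sum>i\<in>I. g i t) = 2 * s t"
  using sum.swap[of "\<lambda>i l. \<psi> l i t" I I] by (simp add: g_def s_def sum.distrib)

lemma sum_offdiag: "i \<in> I \<Longrightarrow> (\<Sum>j\<in>I - {i}. h j) = (\<Sum>j\<in>I. h j) - (h i :: complex)"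
  by (simp add: sum_diff1)

text \<open>Inclusion-exclusion: remove the rows and columns of \<open>i\<close> and
  \<open>j\<close>, then restore the entries \<open>(i, j)\<close> and \<open>(j, i)\<close> that
  were removed twice.\<close>

lemma eigen':
  assumes ij: "i \<in> I" "j \<in> I" "i \<noteq> j" and t: "t \<in> T"
  shows "s t - g i t - g j t + \<psi> i j t + \<psi> j i t + cyc (\<psi> i j) t = \<mu> * \<psi> i j t"
proof -
  have D: "(\<Sum>k\<in>I - {i, j}. h k) = (\<Sum>k\<in>I. h k) - h i - (h j :: complex)" for h
    using ij by (simp add: sum_diff)
  have "(\<Sum>k\<in>I - {i, j}. \<Sum>l\<in>I - {i, j}. \<psi> k l t) = s t - g i t - g j t + \<psi> i j t + \<psi> j i t"
    unfolding D s_def g_def by (simp add: sum_subtractf sum.distrib diag algebra_simps)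
  then show ?thesis using eigen[OF ij t] by (simp add: cyc_def)
qed

text \<open>Adding the equations at \<open>(i, j)\<close> and \<open>(j, i)\<close> and summing over
  \<open>j \<noteq> i\<close> yields an equation in \<open>g\<close> and \<open>s\<close>
  alone.\<close>

lemma eigen_g:
  assumes i: "i \<in> I" and t: "t \<in> T"
  shows "8 * s t - 8 * g i t + cyc (g i) t = \<mu> * g i t"
proof -
  have "(\<Sum>j\<in>I - {i}. 2 * s t - 2 * g i t - 2 * g j t + 2 * (\<psi> i j t + \<psi> j i t)
        + (cyc (\<psi> i j) t + cyc (\<psi> j i) t)) = (\<Sum>j\<in>I - {i}. \<mu> * (\<psi> i j t + \<psi> j i t))"
  proof (intro sum.cong refl)
    fix j assume "j \<in> I - {i}"
    then have j: "j \<in> I" "i \<noteq> j" "j \<noteq> i" by auto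
    show "2 * s t - 2 * g i t - 2 * g j t + 2 * (\<psi> i j t + \<psi> j i t)
        + (cyc (\<psi> i j) t + cyc (\<psi> j i) t) = \<mu> * (\<psi> i j t + \<psi> j i t)"
      using eigen'[OF i j(1,2) t] eigen'[OF j(1) i j(3) t] by Groebner_Basis.algebra
  qed
  moreover have "(\<Sum>j\<in>I. \<psi> i j t + \<psi> j i t) = g i t"
    by (simp add: g_def)
  moreover have "(\<Sum>j\<in>I. cyc (\<psi> i j) t + cyc (\<psi> j i) t) = cyc (g i) t"
    unfolding g_def cyc_sum by (simp add: cyc_add)
  moreover have "cyc (\<psi> i i) t = 0" by (simp add: cyc_def diag)
  ultimately show ?thesis
    unfolding sum_offdiag[OF i]
    by (simp add: sum.distrib sum_subtractf sum_g diag algebra_simps flip: sum_distrib_left) Groebner_Basis.algebra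
qed

text \<open>Summing over \<open>i\<close> as well isolates the constant part; 20 is the degree
  \<open>5 * 4\<close> of the Kneser layer.\<close>

lemma eigen_s:
  assumes t: "t \<in> T"
  shows "20 * s t + cyc s t = \<mu> * s t"
proof -
  have "(\<Sum>i\<in>I. 8 * s t - 8 * g i t + cyc (g i) t) = (\<Sum>i\<in>I. \<mu> * g i t)"
    by (intro sum.cong refl eigen_g t)
  moreover have "(\<Sum>i\<in>I. cyc (g i) t) = 2 * cyc s t"
    by (simp add: sum_g cyc_mult flip: cyc_sum)
  ultimately have "7 * (8 * s t) - 8 * (2 * s t) + 2 * cyc s t = \<mu> * (2 * s t)"
    by (simp add: sum.distrib sum_subtractf sum_g flip: sum_distrib_left)
  then show ?thesis by Groebner_Basis.algebra
qed

text \<open>Subtracting the mean over \<open>i\<close> removes the eigenvalue 20 and leaves only -8,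
  hence the shift by 8.\<close>

lemma eigen_centered:
  assumes "i \<in> I" "t \<in> T"
  shows "cyc (\<lambda>t. g i t - 2/7 * s t) t = (\<mu> + 8) * (g i t - 2/7 * s t)"
  using eigen_g[OF assms] eigen_s[OF assms(2)] unfolding cyc_diff cyc_mult by Groebner_Basis.algebra

text \<open>The Kneser part has eigenvalues 20, 2, 0 and -8, and the cycle perturbs them by at most 2.
  So the eigenvalue -8, whose eigenspace consists of the functions f i + f j with sum zero,
  stays separated from the others.\<close>
lemma eigenspace_dichotomy:
  obtains "\<And>i t. i \<in> I \<Longrightarrow> t \<in> T \<Longrightarrow> g i t - 2/7 * s t = 0"
  | f where "\<And>i j t. i \<in> I \<Longrightarrow> j \<in> I \<Longrightarrow> i \<noteq> j \<Longrightarrow> t \<in> T \<Longrightarrow> \<psi> i j t = f i t + f j t"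
      "\<And>t. t \<in> T \<Longrightarrow> (\<Sum>i\<in>I. f i t) = 0"
      "\<And>i t. i \<in> I \<Longrightarrow> t \<in> T \<Longrightarrow> f i ((t + 1) mod n) + f i ((t - 1) mod n) = (\<mu> + 8) * f i t"
      "\<And>i t. i \<in> I \<Longrightarrow> t \<in> T \<Longrightarrow> g i t - 2/7 * s t = 10 * f i t"
proof (cases "\<forall>i\<in>I. \<forall>t\<in>T. g i t - 2/7 * s t = 0")
  case True
  then show ?thesis using that(1) by blast
next
  case False
  then obtain i0 t0 where "i0 \<in> I" "t0 \<in> T" "g i0 t0 - 2/7 * s t0 \<noteq> 0" by blast
  \<comment> \<open>A nonzero centered part solves the cycle equation, so the maximum principle
    bounds its eigenvalue.\<close>
  then have small: "cmod (\<mu> + 8) \<le> 2"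
    using cyc_zero[OF eigen_centered, of i0 t0] by fastforce
  \<comment> \<open>The other Kneser eigenvalues 20, 0 and 2 lie at distance 28, 8 and 10 from -8,
    hence at distance at least 6 from \<open>\<mu>\<close>.\<close>
  have "cmod (of_real x) \<le> cmod (\<mu> - of_real (x - 8)) + cmod (\<mu> + 8)" for x :: real
    using norm_triangle_ineq4[of "\<mu> + 8" "\<mu> - of_real (x - 8)"] by simp
  from this[of 28] this[of 8] this[of 10]
  have far: "cmod (\<mu> - 20) > 2" "cmod \<mu> > 2" "cmod (\<mu> - 2) > 2"
    using small by simp_all
  have s0: "s t = 0" if "t \<in> T" for t
  proof (rule cyc_zero[OF _ far(1) that])
    fix t assume "t \<in> T"
    then show "cyc s t = (\<mu> - 20) * s t" using eigen_s[of t] by (simp add: algebra_simps)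
  qed
  \<comment> \<open>The antisymmetric part belongs to the Kneser eigenvalue 0.\<close>
  have sym: "\<psi> i j t = \<psi> j i t" if "i \<in> I" "j \<in> I" "t \<in> T" for i j t
  proof (cases "i = j")
    case ne: False
    have "\<psi> i j t - \<psi> j i t = 0"
    proof (rule cyc_zero[OF _ far(2) that(3)])
      fix t assume t: "t \<in> T"
      show "cyc (\<lambda>t. \<psi> i j t - \<psi> j i t) t = \<mu> * (\<psi> i j t - \<psi> j i t)"
        using eigen'[OF that(1,2) ne t] eigen'[OF that(2,1) ne[symmetric] t] unfolding cyc_diff by Groebner_Basis.algebra
    qed
    then show ?thesis by simp
  qed simp
  \<comment> \<open>If \<open>\<psi> i j t = f i t + f j t\<close> with \<open>f\<close> summing to
    zero over the labels, then \<open>g i t = 2 * (6 - 1) * f i t\<close>; this gives the factor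
    10.\<close>
  define f where "f = (\<lambda>i t. g i t / 10)"
  have g10: "g i t = 10 * f i t" for i t by (simp add: f_def)
  have cg: "cyc (g i) t = (\<mu> + 8) * g i t" if "i \<in> I" "t \<in> T" for i t
    using eigen_g[OF that] s0[OF that(2)] by (simp add: algebra_simps)
  have cf: "cyc (f i) t = (\<mu> + 8) * f i t" if "i \<in> I" "t \<in> T" for i t
    using cg[OF that] cyc_mult[of "1/10" "g i" t] by (simp add: f_def)
  \<comment> \<open>The symmetric remainder belongs to the Kneser eigenvalue 2.\<close>
  have "\<psi> i j t - (f i t + f j t) = 0" if ij: "i \<in> I" "j \<in> I" "i \<noteq> j" "t \<in> T" for i j t
  proof (rule cyc_zero[OF _ far(3) ij(4)])
    fix t assume t: "t \<in> T"
    show "cyc (\<lambda>t. \<psi> i j t - (f i t + f j t)) t = (\<mu> - 2) * (\<psi> i j t - (f i t + f j t))"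
      using eigen'[OF ij(1-3) t] sym[OF ij(1,2) t] cf[OF ij(1) t] cf[OF ij(2) t] s0[OF t] g10[of i t] g10[of j t]
      unfolding cyc_diff cyc_add by Groebner_Basis.algebra
  qed
  moreover have "(\<Sum>i\<in>I. f i t) = 0" if "t \<in> T" for t
    using sum_g[of t] s0[OF that] by (simp add: f_def flip: sum_divide_distrib)
  moreover have "f i ((t + 1) mod n) + f i ((t - 1) mod n) = (\<mu> + 8) * f i t"
    if "i \<in> I" "t \<in> T" for i t
    using cf[OF that] by (simp add: cyc_def)
  moreover have "g i t - 2/7 * s t = 10 * f i t" if "i \<in> I" "t \<in> T" for i t
    using s0[OF that(2)] by (simp add: f_def)
  ultimately show ?thesis using that(2)[of f] by (simp add: right_minus_eq)
qed

end

section \<open>Deviation of an eigenfunction from uniformity\<close>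

text \<open>If all entries of Q were 1, then U would be 3/5 on and -1/10 off the diagonal,
  which violates the trace bound.\<close>
lemma gram_deviation:
  fixes U Q :: "int \<Rightarrow> int \<Rightarrow> real"
  assumes I: "finite I" "card I = 7"
    and row: "\<And>i. i \<in> I \<Longrightarrow> (\<Sum>j\<in>I. U i j) = 0"
    and Q: "\<And>i j. i \<in> I \<Longrightarrow> j \<in> I \<Longrightarrow> i \<noteq> j \<Longrightarrow> Q i j = U i i + U j j + 2 * U i j"
    and total: "(\<Sum>i\<in>I. \<Sum>j\<in>I - {i}. Q i j) = 42"
    and trace: "(\<Sum>i\<in>I. U i i)\<^sup>2 \<le> 4 * (\<Sum>i\<in>I. \<Sum>j\<in>I. (U i j)\<^sup>2)"
  shows "(\<Sum>i\<in>I. \<Sum>j\<in>I - {i}. \<bar>Q i j - 1\<bar>) \<ge> 1/20"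
proof (rule ccontr)
  define D where "D = (\<Sum>i\<in>I. \<Sum>j\<in>I - {i}. \<bar>Q i j - 1\<bar>)"
  assume "\<not> D \<ge> 1/20"
  then have D: "D < 1/20" by simp
  define \<tau> where "\<tau> = (\<Sum>i\<in>I. U i i)"
  have rowQ: "(\<Sum>j\<in>I - {i}. Q i j) = 3 * U i i + \<tau>" if i: "i \<in> I" for i
  proof -
    have "(\<Sum>j\<in>I - {i}. Q i j) = (\<Sum>j\<in>I - {i}. U i i + U j j + 2 * U i j)"
      using Q i by (intro sum.cong) auto
    also have "\<dots> = (\<Sum>j\<in>I. U i i + U j j + 2 * U i j) - 4 * U i i"
      using I i by (simp add: sum_diff1)
    also have "\<dots> = 3 * U i i + \<tau>"
      using I row[OF i] by (simp add: sum.distrib \<tau>_def flip: sum_distrib_left)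
    finally show ?thesis .
  qed
  \<comment> \<open>The normalization fixes the trace of \<open>U\<close>, so the diagonal entries
    average to \<open>3/5\<close>.\<close>
  have "42 = (\<Sum>i\<in>I. 3 * U i i + \<tau>)" using total rowQ by simp
  also have "\<dots> = 10 * \<tau>" using I by (simp add: sum.distrib \<tau>_def flip: sum_distrib_left)
  finally have \<tau>: "\<tau> = 21/5" by simp
  have rowD: "(\<Sum>j\<in>I - {i}. \<bar>Q i j - 1\<bar>) < 1/20" if "i \<in> I" for i
  proof -
    have "(\<Sum>j\<in>I - {i}. \<bar>Q i j - 1\<bar>) \<le> D"
      unfolding D_def by (rule member_le_sum[OF that]) (use I in \<open>auto intro: sum_nonneg\<close>)
    then show ?thesis using D by simp
  qed
  have Q1: "\<bar>Q i j - 1\<bar> < 1/20" if "i \<in> I" "j \<in> I" "i \<noteq> j" for i j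
  proof -
    have "\<bar>Q i j - 1\<bar> \<le> (\<Sum>j\<in>I - {i}. \<bar>Q i j - 1\<bar>)"
      by (rule member_le_sum) (use I that in auto)
    then show ?thesis using rowD[OF that(1)] by simp
  qed
  have U1: "\<bar>U i i - 3/5\<bar> < 1/60" if i: "i \<in> I" for i
  proof -
    have "(\<Sum>j\<in>I - {i}. Q i j - 1) = 3 * (U i i - 3/5)"
      using rowQ[OF i] I i \<tau> by (simp add: sum_subtractf)
    moreover have "\<bar>\<Sum>j\<in>I - {i}. Q i j - 1\<bar> < 1/20"
      using rowD[OF i] sum_abs[of "\<lambda>j. Q i j - 1" "I - {i}"] by linarith
    ultimately have "\<bar>3 * (U i i - 3/5)\<bar> < 1/20" by simp
    then show ?thesis unfolding abs_mult by simp
  qed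
  have d: "(U i i)\<^sup>2 \<le> 2/5" if "i \<in> I" for i
  proof -
    have "(U i i)\<^sup>2 \<le> (37/60)\<^sup>2"
      by (rule power_mono) (use U1[OF that] in linarith)+
    then show ?thesis by (simp add: power2_eq_square)
  qed
  have o: "(U i j)\<^sup>2 \<le> 3/100" if "i \<in> I" "j \<in> I" "i \<noteq> j" for i j
  proof -
    \<comment> \<open>The ideal value of \<open>2 * U i j\<close> is \<open>1 - 6/5 = -1/5\<close>
      and the errors add up to less than \<open>1/20 + 2/60 = 1/12\<close>, so the bound is
      \<open>1/10 + 1/24\<close>.\<close>
    have "\<bar>U i j\<bar> \<le> 17/120"
      using Q[OF that] Q1[OF that] U1[OF that(1)] U1[OF that(2)] by linarith
    then have "\<bar>U i j\<bar>\<^sup>2 \<le> (17/120)\<^sup>2" by (rule power_mono) simp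
    then show ?thesis by (simp add: power2_eq_square)
  qed
  have "(\<Sum>i\<in>I. \<Sum>j\<in>I. (U i j)\<^sup>2) \<le> (\<Sum>i\<in>I. \<Sum>j\<in>I. if j = i then 2/5 else 3/100)"
    using d o by (intro sum_mono) auto
  also have "\<dots> = (\<Sum>i\<in>I. 58/100)"
  proof (rule sum.cong[OF refl])
    fix i assume "i \<in> I"
    then show "(\<Sum>j\<in>I. if j = i then 2/5 else 3/100) = (58/100 :: real)"
      using I by (simp add: sum.remove[of I i])
  qed
  also have "\<dots> = 406/100" using I by simp
  \<comment> \<open>The trace bound would demand
    \<open>17.64 \<le> 4 * 4.06 = 16.24\<close>.\<close>
  finally show False using trace unfolding \<tau>_def[symmetric] \<tau> by (simp add: power2_eq_square)
qed

context kneser_cycle_eigenfunction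
begin

text \<open>Either the centered part vanishes, or the left side equals \<open>420 * n\<close> while
  the deviation is at least \<open>1/20\<close>; this explains \<open>8400 = 420 * 20\<close>. The
  number 42 counts the ordered pairs of distinct labels.\<close>

lemma eigenfunction_deviation:
  assumes norm: "(\<Sum>i\<in>I. \<Sum>j\<in>I - {i}. \<Sum>t\<in>T. (cmod (\<psi> i j t))\<^sup>2) = 42 * of_int n"
  shows "(\<Sum>i\<in>I. \<Sum>t\<in>T. (cmod (g i t - 2/7 * s t))\<^sup>2)
    \<le> 8400 * of_int n * (\<Sum>i\<in>I. \<Sum>j\<in>I - {i}. \<bar>(\<Sum>t\<in>T. (cmod (\<psi> i j t))\<^sup>2) / of_int n - 1\<bar>)"
    (is "?W \<le> _ * ?D")
proof (rule eigenspace_dichotomy)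
  assume "\<And>i t. i \<in> I \<Longrightarrow> t \<in> T \<Longrightarrow> g i t - 2/7 * s t = 0"
  then have "?W = 0" by (intro sum.neutral ballI) (simp only: norm_zero zero_power2)
  then show ?thesis using n by (simp add: sum_nonneg)
next
  fix f
  assume \<psi>: "\<And>i j t. i \<in> I \<Longrightarrow> j \<in> I \<Longrightarrow> i \<noteq> j \<Longrightarrow> t \<in> T \<Longrightarrow> \<psi> i j t = f i t + f j t"
    and f0: "\<And>t. t \<in> T \<Longrightarrow> (\<Sum>i\<in>I. f i t) = 0"
    and cyc_f: "\<And>i t. i \<in> I \<Longrightarrow> t \<in> T \<Longrightarrow> f i ((t + 1) mod n) + f i ((t - 1) mod n) = (\<mu> + 8) * f i t"
    and gf: "\<And>i t. i \<in> I \<Longrightarrow> t \<in> T \<Longrightarrow> g i t - 2/7 * s t = 10 * f i t"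
  define V where "V i j = Re (\<Sum>t\<in>T. cnj (f i t) * f j t)" for i j
  define U where "U i j = V i j / of_int n" for i j
  define Q where "Q i j = (\<Sum>t\<in>T. (cmod (\<psi> i j t))\<^sup>2) / of_int n" for i j
  have Vii: "V i i = (\<Sum>t\<in>T. (cmod (f i t))\<^sup>2)" for i
    unfolding V_def Re_sum by (intro sum.cong refl) (simp add: cmod_power2, simp add: power2_eq_square)
  have row: "(\<Sum>j\<in>I. U i j) = 0" for i
  proof -
    have "(\<Sum>j\<in>I. V i j) = Re (\<Sum>t\<in>T. cnj (f i t) * (\<Sum>j\<in>I. f j t))"
      unfolding V_def sum_distrib_left Re_sum by (rule sum.swap)
    also have "\<dots> = 0" by (simp add: f0)
    finally show ?thesis by (simp add: U_def flip: sum_divide_distrib)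
  qed
  have QU: "Q i j = U i i + U j j + 2 * U i j" if "i \<in> I" "j \<in> I" "i \<noteq> j" for i j
  proof -
    have "(\<Sum>t\<in>T. (cmod (\<psi> i j t))\<^sup>2) = V i i + V j j + 2 * V i j"
      unfolding V_def Re_sum sum_distrib_left sum.distrib[symmetric]
      by (intro sum.cong refl) (simp add: \<psi> that cmod_power2, simp add: power2_eq_square algebra_simps)
    then show ?thesis by (simp add: Q_def U_def add_divide_distrib)
  qed
  have total: "(\<Sum>i\<in>I. \<Sum>j\<in>I - {i}. Q i j) = 42"
    using norm n by (simp add: Q_def flip: sum_divide_distrib)
  have "(\<Sum>i\<in>I. V i i)\<^sup>2 \<le> 4 * (\<Sum>i\<in>I. \<Sum>j\<in>I. (V i j)\<^sup>2)"
    by (rule cycle_eigenspace_trace_bound[of n I f "\<mu> + 8"])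
      (use n cyc_f in \<open>auto simp: V_def T_def\<close>)
  then have trace: "(\<Sum>i\<in>I. U i i)\<^sup>2 \<le> 4 * (\<Sum>i\<in>I. \<Sum>j\<in>I. (U i j)\<^sup>2)"
    using n by (simp add: U_def power_divide divide_right_mono flip: sum_divide_distrib)
  have D: "?D \<ge> 1/20"
    using gram_deviation[OF finite_I card_I row QU total trace] by (simp add: Q_def)
  have "(\<Sum>i\<in>I. \<Sum>j\<in>I - {i}. Q i j) = 10 * (\<Sum>i\<in>I. U i i)"
  proof -
    have "(\<Sum>j\<in>I - {i}. Q i j) = 3 * U i i + (\<Sum>j\<in>I. U j j)" if i: "i \<in> I" for i
    proof -
      have "(\<Sum>j\<in>I - {i}. Q i j) = (\<Sum>j\<in>I - {i}. U i i + U j j + 2 * U i j)"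
        using QU i by (intro sum.cong) auto
      then show ?thesis
        using i by (simp add: sum_diff1 sum.distrib row flip: sum_distrib_left)
    qed
    then show ?thesis by (simp add: sum.distrib flip: sum_distrib_left)
  qed
  then have "(\<Sum>i\<in>I. V i i) = 21/5 * of_int n"
    using total n by (simp add: U_def field_simps flip: sum_divide_distrib)
  moreover have "?W = 100 * (\<Sum>i\<in>I. V i i)"
    unfolding Vii sum_distrib_left by (intro sum.cong refl) (simp only: gf norm_mult power_mult_distrib, simp)
  ultimately have "?W = 8400 * of_int n * (1/20)" by simp
  also have "\<dots> \<le> 8400 * of_int n * ?D" using D n by (intro mult_left_mono) auto
  finally show ?thesis .
qed

end

section \<open>Completeness and Parseval for orthonormal bases\<close>

text \<open>Orthonormality makes the scaled adjoint of the square matrix of basis values a left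
  inverse. It is then also a right inverse, whose entries give the dual orthogonality
  relation.\<close>

lemma orthonormal_basis_complete:
  assumes X: "finite X" and B: "orthonormal_basis X B" and xy: "x \<in> X" "y \<in> X"
  shows "(\<Sum>\<phi>\<in>B. cnj (\<phi> x) * \<phi> y) = (if x = y then of_nat (card X) else 0)"
proof -
  define N where "N = card X"
  have N: "N > 0" using X xy by (auto simp: N_def card_gt_0_iff)
  have finB: "finite B" and cB: "card B = N"
    using B by (auto simp: orthonormal_basis_def N_def)
  obtain u where u: "bij_betw u {0..<N} X"
    using ex_bij_betw_nat_finite[OF X] by (auto simp: N_def)
  obtain b where b: "bij_betw b {0..<N} B"
    using ex_bij_betw_nat_finite[OF finB] by (auto simp: cB)
  have ip: "(\<Sum>z\<in>X. cnj (\<phi> z) * \<psi> z) / of_nat N = (if \<phi> = \<psi> then 1 else 0)"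
    if "\<phi> \<in> B" "\<psi> \<in> B" for \<phi> \<psi>
  proof (cases "\<phi> = \<psi>")
    case True
    have "norm2_on X \<phi> = 1" using B that by (simp add: orthonormal_basis_def)
    then have "(\<Sum>z\<in>X. (cmod (\<phi> z))\<^sup>2) = of_nat N"
      using N by (simp add: norm2_on_def expect_def N_def)
    moreover have "(\<Sum>z\<in>X. cnj (\<phi> z) * \<phi> z) = of_real (\<Sum>z\<in>X. (cmod (\<phi> z))\<^sup>2)"
      by (simp add: complex_norm_square mult.commute del: of_real_power)
    ultimately show ?thesis using True N by simp
  next
    case False
    then have "inner_on X \<phi> \<psi> = 0" using B that by (simp add: orthonormal_basis_def)
    then show ?thesis using False N by (simp add: inner_on_def expect_def N_def)
  qed
  define A where "A = mat N N (\<lambda>(k, l). cnj (b k (u l)) / of_nat N)"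
  define M where "M = mat N N (\<lambda>(l, k). b k (u l))"
  have AM: "A \<in> carrier_mat N N" "M \<in> carrier_mat N N" by (simp_all add: A_def M_def)
  have "A * M = 1\<^sub>m N"
  proof (rule eq_matI)
    fix k l assume kl: "k < dim_row (1\<^sub>m N)" "l < dim_col (1\<^sub>m N)"
    have "(A * M) $$ (k, l) = (\<Sum>m\<in>{0..<N}. cnj (b k (u m)) / of_nat N * b l (u m))"
      using kl by (simp add: A_def M_def scalar_prod_def)
    also have "\<dots> = (\<Sum>z\<in>X. cnj (b k z) * b l z) / of_nat N"
      using sum.reindex_bij_betw[OF u, of "\<lambda>z. cnj (b k z) * b l z"] by (simp flip: sum_divide_distrib)
    also have "\<dots> = (if b k = b l then 1 else 0)"
      using kl b by (intro ip) (auto simp: bij_betw_def)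
    also have "\<dots> = 1\<^sub>m N $$ (k, l)"
      using kl b by (auto simp: bij_betw_def inj_on_eq_iff)
    finally show "(A * M) $$ (k, l) = 1\<^sub>m N $$ (k, l)" .
  qed (simp_all add: A_def M_def)
  then have MA: "M * A = 1\<^sub>m N"
    by (rule mat_mult_left_right_inverse[OF AM])
  obtain p q where p: "p < N" "u p = x" and q: "q < N" "u q = y"
    using u xy by (auto simp: bij_betw_def image_iff dest!: equalityD2 subsetD)
  have "(\<Sum>\<phi>\<in>B. cnj (\<phi> x) * \<phi> y) = (\<Sum>k\<in>{0..<N}. cnj (b k x) * b k y)"
    using sum.reindex_bij_betw[OF b, of "\<lambda>\<phi>. cnj (\<phi> x) * \<phi> y"] by simp
  also have "\<dots> = of_nat N * (M * A) $$ (q, p)"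
    using p q N by (simp add: A_def M_def scalar_prod_def sum_distrib_left mult.commute)
  also have "\<dots> = (if x = y then of_nat N else 0)"
    using p q u by (auto simp: MA bij_betw_def inj_on_eq_iff)
  finally show ?thesis by (simp add: N_def)
qed

text \<open>After expanding the square and summing over the basis first, completeness leaves only
  the diagonal terms.\<close>

lemma orthonormal_basis_parseval:
  assumes X: "finite X" and B: "orthonormal_basis X B" and e: "bij_betw e P X"
  shows "(\<Sum>\<phi>\<in>B. (cmod (\<Sum>p\<in>P. of_real (c p) * \<phi> (e p)))\<^sup>2) = real (card X) * (\<Sum>p\<in>P. (c p)\<^sup>2)"
proof -
  have finP: "finite P" using e X bij_betw_finite by auto
  have "complex_of_real (\<Sum>\<phi>\<in>B. (cmod (\<Sum>p\<in>P. of_real (c p) * \<phi> (e p)))\<^sup>2) =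
     (\<Sum>\<phi>\<in>B. (\<Sum>p\<in>P. of_real (c p) * cnj (\<phi> (e p))) * (\<Sum>q\<in>P. of_real (c q) * \<phi> (e q)))"
    by (simp add: complex_norm_square mult.commute del: of_real_power)
  also have "\<dots> = (\<Sum>\<phi>\<in>B. \<Sum>p\<in>P. \<Sum>q\<in>P. of_real (c p * c q) * (cnj (\<phi> (e p)) * \<phi> (e q)))"
    unfolding sum_product by (simp add: mult_ac)
  also have "\<dots> = (\<Sum>p\<in>P. \<Sum>q\<in>P. of_real (c p * c q) * (\<Sum>\<phi>\<in>B. cnj (\<phi> (e p)) * \<phi> (e q)))"
    unfolding sum_distrib_left by (subst sum.swap, subst (2) sum.swap) simp
  also have "\<dots> = (\<Sum>p\<in>P. \<Sum>q\<in>P. if p = q then of_real (c p * c q) * of_nat (card X) else 0)"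
    using e by (intro sum.cong refl)
      (auto simp: orthonormal_basis_complete[OF X B] bij_betw_def inj_on_eq_iff)
  also have "\<dots> = of_real (real (card X) * (\<Sum>p\<in>P. (c p)\<^sup>2))"
    using finP by (simp add: sum_distrib_left power2_eq_square mult_ac)
  finally show ?thesis unfolding of_real_eq_iff .
qed

section \<open>The graph and the failure of quantum ergodicity\<close>

definition verts :: "int \<Rightarrow> (int \<times> int \<times> int) set" where
  "verts n = (SIGMA i:{0..<7}. SIGMA j:{0..<7} - {i}. {0..<n})"

definition adj :: "int \<Rightarrow> int \<times> int \<times> int \<Rightarrow> int \<times> int \<times> int \<Rightarrow> bool" where
  "adj n = (\<lambda>(i, j, t) (k, l, u). t = u \<and> {i, j} \<inter> {k, l} = {} \<or>
     i = k \<and> j = l \<and> (u = (t + 1) mod n \<or> u = (t - 1) mod n))"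

lemma vertsE:
  assumes "p \<in> verts n"
  obtains i j t where "p = (i, j, t)" "i \<in> {0..<7}" "j \<in> {0..<7}" "i \<noteq> j" "t \<in> {0..<n}"
  using assms unfolding verts_def by blast

lemma sum_Sigma_triple:
  assumes "finite A" "\<And>i. finite (B i)" "\<And>i j. finite (C i j)"
  shows "(\<Sum>p\<in>(SIGMA i:A. SIGMA j:B i. C i j). F p) = (\<Sum>i\<in>A. \<Sum>j\<in>B i. \<Sum>t\<in>C i j. F (i, j, t))"
  using assms by (simp add: sum.Sigma case_prod_beta')

lemma finite_verts [simp]: "finite (verts n)"
  by (simp add: verts_def)

lemma sum_verts:
  "(\<Sum>p\<in>verts n. F p) = (\<Sum>i\<in>{0..<7}. \<Sum>j\<in>{0..<7} - {i}. \<Sum>t\<in>{0..<n}. F (i, j, t))"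
  unfolding verts_def by (rule sum_Sigma_triple) auto

lemma card_verts: "n \<ge> 0 \<Longrightarrow> card (verts n) = 42 * nat n"
  by (simp add: verts_def card_SigmaI)

text \<open>The neighbourhood splits into a Kneser part in the layer \<open>t\<close> and two cycle
  neighbours. Zero values on the diagonal allow \<open>l\<close> to take the value \<open>k\<close>
  too.\<close>

lemma sum_neighbours:
  fixes F :: "int \<times> int \<times> int \<Rightarrow> complex"
  assumes n: "n > 2" and p: "(i, j, t) \<in> verts n" and diag: "\<And>k t. F (k, k, t) = 0"
  shows "(\<Sum>q\<in>{q \<in> verts n. adj n (i, j, t) q}. F q) =
    (\<Sum>k\<in>{0..<7} - {i, j}. \<Sum>l\<in>{0..<7} - {i, j}. F (k, l, t))
    + (F (i, j, (t + 1) mod n) + F (i, j, (t - 1) mod n))"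
proof -
  let ?I = "{0..<7::int}"
  define A where "A = (SIGMA k:?I - {i, j}. SIGMA l:?I - {i, j} - {k}. {t})"
  let ?B = "{(i, j, (t + 1) mod n), (i, j, (t - 1) mod n)}"
  have "{q \<in> verts n. adj n (i, j, t) q} = A \<union> ?B"
    using n p by (auto simp: verts_def adj_def A_def)
  moreover have "A \<inter> ?B = {}" by (auto simp: A_def)
  \<comment> \<open>A coincidence would make \<open>n\<close> divide 2.\<close>
  moreover have "(t + 1) mod n \<noteq> (t - 1) mod n"
  proof
    assume "(t + 1) mod n = (t - 1) mod n"
    then have "n dvd (t + 1) - (t - 1)" by (simp add: mod_eq_dvd_iff)
    then show False using n zdvd_not_zless[of 2 n] by simp
  qed
  moreover have "sum F A = (\<Sum>k\<in>?I - {i, j}. \<Sum>l\<in>?I - {i, j} - {k}. F (k, l, t))"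
    unfolding A_def by (subst sum_Sigma_triple) auto
  moreover have "\<dots> = (\<Sum>k\<in>?I - {i, j}. \<Sum>l\<in>?I - {i, j}. F (k, l, t))"
    by (intro sum.cong refl sum.mono_neutral_left) (auto simp: diag)
  ultimately show ?thesis
    by (simp add: sum.union_disjoint A_def)
qed

text \<open>These are the weights with which a vertex over \<open>(k, l)\<close> enters the centered
  sums: two are \<open>5/7\<close> and five are \<open>-2/7\<close>.\<close>

lemma centering_weights:
  fixes k l :: int
  assumes "k \<in> {0..<7}" "l \<in> {0..<7}" "k \<noteq> l"
  shows "(\<Sum>i\<in>{0..<7}. (of_bool (k = i) + of_bool (l = i) - 2/7 :: real)\<^sup>2) = 10/7"
proof -
  have *: "(of_bool (k = i) + of_bool (l = i) - 2/7 :: real)\<^sup>2 =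
      (if i = k then 3/7 else 0) + (if i = l then 3/7 else 0) + 4/49" for i
    using assms by (auto simp: power2_eq_square)
  show ?thesis unfolding * using assms by (simp add: sum.distrib)
qed

text \<open>The squared norms of the centered parts, summed over the basis, are estimated twice.
  Parseval gives exactly \<open>2520 * n^2\<close>; quantum ergodicity, tested on the 42 fibres over
  the pairs \<open>(i, j)\<close>, bounds the deviations and hence the sum by less than
  \<open>623 * n^2\<close>.\<close>

lemma kneser_cycle_not_quantum_ergodic:
  fixes e :: "int \<times> int \<times> int \<Rightarrow> 'a"
  assumes n: "n > 2" and e: "bij_betw e (verts n) X"
    and E: "\<And>p q. p \<in> verts n \<Longrightarrow> q \<in> verts n \<Longrightarrow> {e p, e q} \<in> E \<longleftrightarrow> adj n p q"
    and B: "orthonormal_eigenbasis X E B"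
  shows "\<not> quantum_ergodic (1 / 10 ^ 6) X B"
proof
  assume qe: "quantum_ergodic (1 / 10 ^ 6) X B"
  let ?I = "{0..<7::int}" and ?T = "{0..<n}"
  have onb: "orthonormal_basis X B" and ef: "\<And>\<phi>. \<phi> \<in> B \<Longrightarrow> eigenfunction X E \<phi>"
    using B by (auto simp: orthonormal_eigenbasis_def)
  have finX: "finite X" using e bij_betw_finite by fastforce
  have cardX: "real (card X) = 42 * of_int n"
    using bij_betw_same_card[OF e] card_verts[of n] n by simp
  have cardB: "real (card B) = 42 * of_int n" and finB: "finite B"
    using onb cardX by (auto simp: orthonormal_basis_def)
  have X: "X = e ` verts n" and inj: "inj_on e (verts n)" using e by (auto simp: bij_betw_def)
  have sumX: "(\<Sum>x\<in>X. F x) = (\<Sum>p\<in>verts n. F (e p))" for F :: "'a \<Rightarrow> 'b::comm_monoid_add"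
    using sum.reindex_bij_betw[OF e, of F] by simp
  define \<psi> where "\<psi> \<phi> i j t = (if i = j then 0 else \<phi> (e (i, j, t)))" for \<phi> :: "'a \<Rightarrow> complex" and i j t
  define Q where "Q \<phi> i j = (\<Sum>t\<in>?T. (cmod (\<psi> \<phi> i j t))\<^sup>2) / of_int n" for \<phi> i j
  \<comment> \<open>The coefficients of the linear functional that sends an eigenfunction to its
    centered sum at \<open>(i, t)\<close>, as Parseval requires.\<close>
  define c where "c i t = (\<lambda>(k, l, u). if u = t then of_bool (k = i) + of_bool (l = i) - 2/7 else (0::real))"
    for i t :: int
  have dev: "(\<Sum>i\<in>?I. \<Sum>t\<in>?T. (cmod (\<Sum>p\<in>verts n. of_real (c i t p) * \<phi> (e p)))\<^sup>2)
      \<le> 8400 * of_int n * (\<Sum>i\<in>?I. \<Sum>j\<in>?I - {i}. \<bar>Q \<phi> i j - 1\<bar>)" if \<phi>: "\<phi> \<in> B" for \<phi>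
  proof -
    obtain \<mu> where \<mu>: "\<And>x. x \<in> X \<Longrightarrow> adjacency_op X E \<phi> x = \<mu> * \<phi> x"
      using ef[OF \<phi>] by (auto simp: eigenfunction_def)
    have eig: "(\<Sum>k\<in>?I - {i, j}. \<Sum>l\<in>?I - {i, j}. \<psi> \<phi> k l t)
        + (\<psi> \<phi> i j ((t + 1) mod n) + \<psi> \<phi> i j ((t - 1) mod n)) = \<mu> * \<psi> \<phi> i j t"
      if ij: "i \<in> ?I" "j \<in> ?I" "i \<noteq> j" "t \<in> ?T" for i j t
    proof -
      have v: "(i, j, t) \<in> verts n" using ij by (simp add: verts_def)
      have "{y \<in> X. {e (i, j, t), y} \<in> E} = e ` {q \<in> verts n. adj n (i, j, t) q}"
        using E[OF v] by (auto simp: X)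
      then have "adjacency_op X E \<phi> (e (i, j, t)) = (\<Sum>q\<in>{q \<in> verts n. adj n (i, j, t) q}. \<phi> (e q))"
        using inj by (simp add: adjacency_op_def sum.reindex inj_on_subset)
      also have "\<dots> = (\<Sum>q\<in>{q \<in> verts n. adj n (i, j, t) q}. (\<lambda>(i, j, t). \<psi> \<phi> i j t) q)"
        by (intro sum.cong refl) (auto simp: \<psi>_def verts_def split: if_splits)
      also have "\<dots> = (\<Sum>k\<in>?I - {i, j}. \<Sum>l\<in>?I - {i, j}. \<psi> \<phi> k l t)
        + (\<psi> \<phi> i j ((t + 1) mod n) + \<psi> \<phi> i j ((t - 1) mod n))"
        by (subst sum_neighbours[OF n v]) (auto simp: \<psi>_def)
      finally show ?thesis using \<mu>[of "e (i, j, t)"] v ij by (simp add: X \<psi>_def)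
    qed
    interpret K: kneser_cycle_eigenfunction n "\<psi> \<phi>" \<mu> ?I ?T
      by unfold_locales (use n eig in \<open>auto simp: \<psi>_def\<close>)
    have "norm2_on X \<phi> = 1" using onb \<phi> by (simp add: orthonormal_basis_def)
    then have "(\<Sum>x\<in>X. (cmod (\<phi> x))\<^sup>2) = 42 * of_int n"
      using n cardX by (simp add: norm2_on_def expect_def)
    moreover have "(\<Sum>x\<in>X. (cmod (\<phi> x))\<^sup>2) = (\<Sum>i\<in>?I. \<Sum>j\<in>?I - {i}. \<Sum>t\<in>?T. (cmod (\<psi> \<phi> i j t))\<^sup>2)"
      unfolding sumX sum_verts by (intro sum.cong refl) (auto simp: \<psi>_def)
    ultimately have norm: "(\<Sum>i\<in>?I. \<Sum>j\<in>?I - {i}. \<Sum>t\<in>?T. (cmod (\<psi> \<phi> i j t))\<^sup>2) = 42 * of_int n"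
      by simp
    have "(\<Sum>p\<in>verts n. of_real (c i t p) * \<phi> (e p)) = K.g i t - 2/7 * K.s t"
      if "i \<in> ?I" "t \<in> ?T" for i t
    proof -
      have "(\<Sum>p\<in>verts n. of_real (c i t p) * \<phi> (e p)) =
          (\<Sum>k\<in>?I. \<Sum>l\<in>?I - {k}. \<Sum>u\<in>?T. if u = t
             then (of_bool (k = i) + of_bool (l = i) - 2/7) * \<psi> \<phi> k l u else 0)"
        unfolding sum_verts by (intro sum.cong refl) (auto simp: \<psi>_def c_def)
      also have "\<dots> = (\<Sum>k\<in>?I. \<Sum>l\<in>?I - {k}. (of_bool (k = i) + of_bool (l = i) - 2/7) * \<psi> \<phi> k l t)"
        using that by (simp add: sum.delta)
      also have "\<dots> = (\<Sum>k\<in>?I. \<Sum>l\<in>?I. (of_bool (k = i) + of_bool (l = i) - 2/7) * \<psi> \<phi> k l t)"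
        by (intro sum.cong refl sum.mono_neutral_left) (auto simp: \<psi>_def)
      also have "\<dots> = (\<Sum>k\<in>?I. of_bool (k = i) * (\<Sum>l\<in>?I. \<psi> \<phi> k l t))
          + (\<Sum>k\<in>?I. \<Sum>l\<in>?I. of_bool (l = i) * \<psi> \<phi> k l t) - 2/7 * (\<Sum>k\<in>?I. \<Sum>l\<in>?I. \<psi> \<phi> k l t)"
        by (simp add: algebra_simps sum.distrib sum_subtractf sum_distrib_left)
      also have "\<dots> = (\<Sum>l\<in>?I. \<psi> \<phi> i l t) + (\<Sum>k\<in>?I. \<psi> \<phi> k i t) - 2/7 * (\<Sum>k\<in>?I. \<Sum>l\<in>?I. \<psi> \<phi> k l t)"
        using that by (simp add: of_bool_def if_distrib[of "\<lambda>x. x * _"] sum.delta cong: if_cong)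
      finally show ?thesis by (simp add: K.g_def K.s_def sum.distrib)
    qed
    then show ?thesis using K.eigenfunction_deviation[OF norm] by (simp add: Q_def)
  qed
  have test: "(\<Sum>\<phi>\<in>B. \<bar>Q \<phi> i j - 1\<bar>) \<le> 42 * 42 * of_int n / 10 ^ 6"
    if ij: "i \<in> ?I" "j \<in> ?I - {i}" for i j
  proof -
    define Y where "Y = (\<lambda>t. e (i, j, t)) ` ?T"
    \<comment> \<open>The indicator of the fibre over \<open>(i, j)\<close>, which is
      \<open>1/42\<close> of all vertices; paired with the squared modulus of \<open>\<phi>\<close>
      it gives \<open>Q \<phi> i j / 42\<close>.\<close>
    define f :: "'a \<Rightarrow> complex" where "f x = of_bool (x \<in> Y)" for x
    have sub: "(\<lambda>t. (i, j, t)) ` ?T \<subseteq> verts n" using ij by (auto simp: verts_def)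
    have Y: "Y \<subseteq> X" using sub by (auto simp: Y_def X)
    have injY: "inj_on (\<lambda>t. e (i, j, t)) ?T"
      using inj sub by (auto simp: inj_on_def image_subset_iff)
    have sumY: "(\<Sum>x\<in>X. f x * h x) = (\<Sum>t\<in>?T. h (e (i, j, t)))" for h
    proof -
      have "(\<Sum>x\<in>X. f x * h x) = (\<Sum>x\<in>Y. h x)"
        using Y finX by (simp add: f_def of_bool_def if_distrib[of "\<lambda>x. x * _"] sum.If_cases Int_absorb1 cong: if_cong)
      then show ?thesis using injY by (simp add: Y_def sum.reindex)
    qed
    have sup: "sup_norm_on X f \<le> 1"
      unfolding sup_norm_on_def
    proof (subst Max_le_iff)
      show "(\<lambda>x. cmod (f x)) ` X \<noteq> {}" using cardX n by auto
    qed (use finX in \<open>auto simp: f_def\<close>)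
    have mean: "expect X f = 1 / 42"
      using sumY[of "\<lambda>_. 1"] n cardX by (simp add: expect_def complex_eq_iff)
    have dv: "cmod (expect X (\<lambda>x. f x * of_real ((cmod (\<phi> x))\<^sup>2)) - expect X f) = \<bar>Q \<phi> i j - 1\<bar> / 42" for \<phi>
    proof -
      have "complex_of_nat (card X) = of_real (42 * of_int n)"
        unfolding cardX[symmetric] by simp
      then have "expect X (\<lambda>x. f x * of_real ((cmod (\<phi> x))\<^sup>2)) = of_real (Q \<phi> i j / 42)"
        unfolding expect_def sumY using ij by (simp add: Q_def \<psi>_def)
      then have "expect X (\<lambda>x. f x * of_real ((cmod (\<phi> x))\<^sup>2)) - expect X f = of_real ((Q \<phi> i j - 1) / 42)"
        by (simp add: mean diff_divide_distrib)
      then show ?thesis by (simp only: norm_of_real abs_divide)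
    qed
    have "expect B (\<lambda>\<phi>. \<bar>Q \<phi> i j - 1\<bar> / 42) \<le> 1 / 10 ^ 6 * sup_norm_on X f"
      using qe[unfolded quantum_ergodic_def, rule_format, of f] by (simp only: dv)
    then have "(\<Sum>\<phi>\<in>B. \<bar>Q \<phi> i j - 1\<bar>) / 42 / real (card B) \<le> 1 / 10 ^ 6 * sup_norm_on X f"
      by (simp add: expect_def flip: sum_divide_distrib)
    also have "\<dots> \<le> 1 / 10 ^ 6" using sup by simp
    \<comment> \<open>One factor 42 is the inverse density of the fibre, the other comes from the
      \<open>42 * n\<close> elements of \<open>B\<close>.\<close>
    finally show ?thesis using n unfolding cardB by (simp add: field_simps)
  qed
  \<comment> \<open>Each of the \<open>42 * n\<close> vertices contributes \<open>10/7\<close>, in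
    total \<open>60 * n\<close>.\<close>
  have "60 * of_int n * (42 * of_int n) =
      real (card X) * (\<Sum>p\<in>verts n. \<Sum>i\<in>?I. \<Sum>t\<in>?T. (c i t p)\<^sup>2)"
  proof -
    have "(\<Sum>i\<in>?I. \<Sum>t\<in>?T. (c i t p)\<^sup>2) = 10/7" if "p \<in> verts n" for p
    proof -
      obtain k l u where p: "p = (k, l, u)" "k \<in> ?I" "l \<in> ?I" "k \<noteq> l" "u \<in> ?T"
        using \<open>p \<in> verts n\<close> by (rule vertsE)
      have "(\<Sum>i\<in>?I. \<Sum>t\<in>?T. (c i t p)\<^sup>2) =
          (\<Sum>i\<in>?I. \<Sum>t\<in>?T. if u = t then (of_bool (k = i) + of_bool (l = i) - 2/7 :: real)\<^sup>2 else 0)"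
        by (intro sum.cong refl) (simp add: c_def p(1))
      also have "\<dots> = (\<Sum>i\<in>?I. (of_bool (k = i) + of_bool (l = i) - 2/7 :: real)\<^sup>2)"
        using p(5) by simp
      finally show ?thesis using centering_weights[OF p(2-4)] by simp
    qed
    then have "(\<Sum>p\<in>verts n. \<Sum>i\<in>?I. \<Sum>t\<in>?T. (c i t p)\<^sup>2) = (\<Sum>p\<in>verts n. 10/7)"
      by (intro sum.cong refl)
    then show ?thesis using card_verts[of n] n cardX by simp
  qed
  also have "\<dots> = (\<Sum>i\<in>?I. \<Sum>t\<in>?T. real (card X) * (\<Sum>p\<in>verts n. (c i t p)\<^sup>2))"
    unfolding sum_distrib_left by (subst sum.swap, subst (2) sum.swap) simp
  also have "\<dots> = (\<Sum>i\<in>?I. \<Sum>t\<in>?T. \<Sum>\<phi>\<in>B. (cmod (\<Sum>p\<in>verts n. of_real (c i t p) * \<phi> (e p)))\<^sup>2)"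
    by (simp only: orthonormal_basis_parseval[OF finX onb e])
  also have "\<dots> = (\<Sum>\<phi>\<in>B. \<Sum>i\<in>?I. \<Sum>t\<in>?T. (cmod (\<Sum>p\<in>verts n. of_real (c i t p) * \<phi> (e p)))\<^sup>2)"
    by (subst (2) sum.swap, subst sum.swap) simp
  also have "\<dots> \<le> (\<Sum>\<phi>\<in>B. 8400 * of_int n * (\<Sum>i\<in>?I. \<Sum>j\<in>?I - {i}. \<bar>Q \<phi> i j - 1\<bar>))"
    by (intro sum_mono dev)
  also have "\<dots> = 8400 * of_int n * (\<Sum>i\<in>?I. \<Sum>j\<in>?I - {i}. \<Sum>\<phi>\<in>B. \<bar>Q \<phi> i j - 1\<bar>)"
    unfolding sum_distrib_left[symmetric] by (subst sum.swap, subst (2) sum.swap) simp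
  also have "\<dots> \<le> 8400 * of_int n * (\<Sum>i\<in>?I. \<Sum>j\<in>?I - {i}. 42 * 42 * of_int n / 10 ^ 6)"
    using n by (intro mult_left_mono sum_mono test) auto
  also have "\<dots> = 8400 * of_int n * (42 * (42 * 42 * of_int n / 10 ^ 6))" by simp
  finally show False using n by (simp add: field_simps)
qed

section \<open>The affine group times a cyclic group\<close>

text \<open>A vertex (i, j, t) stands for the affine map of the field with 7 elements that sends 0 to i
  and 1 to j, together with a residue t modulo n. Affine maps are composed from left to right, so
  that right multiplication permutes the labels i and j.\<close>
definition vmult :: "int \<Rightarrow> int \<times> int \<times> int \<Rightarrow> int \<times> int \<times> int \<Rightarrow> int \<times> int \<times> int" where
  "vmult n = (\<lambda>(i, j, t) (k, l, u). ((k + (l - k) * i) mod 7, (k + (l - k) * j) mod 7, (t + u) mod n))"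

text \<open>The slope \<open>l - k\<close> is invertible modulo the prime 7.\<close>

lemma affine_mod_7_inj:
  fixes i j :: int
  assumes "i \<in> {0..<7}" "j \<in> {0..<7}" "k \<in> {0..<7}" "l \<in> {0..<7}" "k \<noteq> l"
  shows "(k + (l - k) * i) mod 7 = (k + (l - k) * j) mod 7 \<longleftrightarrow> i = j"
proof
  assume "(k + (l - k) * i) mod 7 = (k + (l - k) * j) mod 7"
  then have "7 dvd (l - k) * (i - j)" by (simp add: mod_eq_dvd_iff algebra_simps)
  moreover have "prime (7 :: int)" by simp
  ultimately have "7 dvd l - k \<or> 7 dvd i - j" by (simp add: prime_dvd_mult_iff)
  then show "i = j" using assms by (auto dest: zdvd_imp_le) presburger+
qed simp

lemma vmult_closed: "p \<in> verts n \<Longrightarrow> q \<in> verts n \<Longrightarrow> vmult n p q \<in> verts n"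
  using affine_mod_7_inj by (auto simp: vmult_def verts_def)

lemma vmult_assoc: "vmult n (vmult n p q) r = vmult n p (vmult n q r)"
proof -
  \<comment> \<open>Applying the maps \<open>(k, l)\<close> and \<open>(m, h)\<close> in turn to
    \<open>i\<close> agrees with applying the composite, which is encoded by its own images of 0 and
    1.\<close>
  have "(m + (h - m) * ((k + (l - k) * i) mod 7)) mod 7 =
      ((m + (h - m) * k) mod 7 + ((m + (h - m) * l) mod 7 - (m + (h - m) * k) mod 7) * i) mod 7"
    for i k l m h :: int
  proof -
    have "(m + (h - m) * ((k + (l - k) * i) mod 7)) mod 7 = (m + (h - m) * (k + (l - k) * i)) mod 7"
      by (intro mod_add_cong mod_mult_cong) simp_all
    also have "m + (h - m) * (k + (l - k) * i) =
        (m + (h - m) * k) + ((m + (h - m) * l) - (m + (h - m) * k)) * i"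
      by (simp add: algebra_simps)
    also have "\<dots> mod 7 =
        ((m + (h - m) * k) mod 7 + ((m + (h - m) * l) mod 7 - (m + (h - m) * k) mod 7) * i) mod 7"
      by (intro mod_add_cong mod_mult_cong mod_diff_cong) simp_all
    finally show ?thesis .
  qed
  then show ?thesis
    by (cases p, cases q, cases r) (simp add: vmult_def mod_simps add.assoc)
qed

lemma vmult_one: "p \<in> verts n \<Longrightarrow> vmult n (0, 1, 0) p = p"
  by (auto simp: vmult_def verts_def)

lemma one_in_verts: "n > 0 \<Longrightarrow> (0, 1, 0) \<in> verts n"
  by (simp add: verts_def)

text \<open>An injective self-map of the seven labels is onto; the preimages of 0 and 1 encode the
  inverse map.\<close>

lemma vmult_inverse:
  assumes p: "p \<in> verts n" and n: "n > 0"
  shows "\<exists>q\<in>verts n. vmult n q p = (0, 1, 0)"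
proof -
  obtain k l t where p': "p = (k, l, t)" and kl: "k \<in> {0..<7}" "l \<in> {0..<7}" "k \<noteq> l"
    using p by (rule vertsE)
  define h where "h i = (k + (l - k) * i) mod 7" for i
  have "inj_on h {0..<7}"
    using affine_mod_7_inj[OF _ _ kl] by (auto simp: inj_on_def h_def)
  moreover have "h ` {0..<7} \<subseteq> {0..<7}" by (auto simp: h_def)
  ultimately have "h ` {0..<7} = {0..<7}" by (intro endo_inj_surj) auto
  then have "0 \<in> h ` {0..<7}" "1 \<in> h ` {0..<7}" by auto
  then obtain i j where ij: "i \<in> {0..<7}" "h i = 0" "j \<in> {0..<7}" "h j = 1"
    by (elim imageE) auto
  then have "(i, j, (- t) mod n) \<in> verts n" using n by (auto simp: verts_def)
  moreover have "vmult n (i, j, (- t) mod n) p = (0, 1, 0)"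
    using ij by (simp add: vmult_def p' h_def mod_simps)
  ultimately show ?thesis by blast
qed

text \<open>Right multiplication applies one injective map to all labels and one shift to both cycle
  coordinates. Such invariance makes the graph Cayley for the convention
  \<open>g \<otimes> inv h\<close>.\<close>

lemma adj_vmult:
  assumes n: "n > 0" and pq: "p \<in> verts n" "q \<in> verts n" "r \<in> verts n" and a: "adj n p q"
  shows "adj n (vmult n p r) (vmult n q r)"
proof -
  obtain i j t where p: "p = (i, j, t)" "i \<in> {0..<7}" "j \<in> {0..<7}" using pq(1) by (rule vertsE)
  obtain k l u where q: "q = (k, l, u)" "k \<in> {0..<7}" "l \<in> {0..<7}" using pq(2) by (rule vertsE)
  obtain x y z where r: "r = (x, y, z)" "x \<in> {0..<7}" "y \<in> {0..<7}" "x \<noteq> y"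
    using pq(3) by (rule vertsE)
  have "((t + 1) mod n + z) mod n = ((t + z) mod n + 1) mod n"
    "((t - 1) mod n + z) mod n = ((t + z) mod n - 1) mod n"
    by (simp_all add: mod_simps algebra_simps)
  then show ?thesis
    using a p q r affine_mod_7_inj[OF _ _ r(2-4)]
    by (auto simp: adj_def vmult_def)
qed

lemma adj_sym:
  assumes "p \<in> verts n" "q \<in> verts n" "adj n p q"
  shows "adj n q p"
  using assms by (auto simp: adj_def verts_def mod_simps)

text \<open>At most four of the seven labels are excluded, so two remain for \<open>k\<close> and
  \<open>l\<close>.\<close>

lemma common_neighbour:
  fixes i j :: int
  obtains k l where "k \<in> {0..<7}" "l \<in> {0..<7}" "k \<noteq> l" "{0, 1} \<inter> {k, l} = {}" "{k, l} \<inter> {i, j} = {}"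
proof -
  have "card {0, 1, i, j} \<le> 4"
    using card_length[of "[0, 1, i, j]"] by simp
  then have "card ({0..<7} - {0, 1, i, j}) \<ge> 2"
    using diff_card_le_card_Diff[of "{0, 1, i, j}" "{0..<7}"] by simp
  then obtain S where "S \<subseteq> {0..<7} - {0, 1, i, j}" "card S = 2"
    using obtain_subset_with_card_n by metis
  then obtain k l where "k \<noteq> l" "{k, l} \<subseteq> {0..<7} - {0, 1, i, j}"
    by (auto simp: card_2_iff)
  then show ?thesis using that by auto
qed

text \<open>Connectedness as an induction principle: walk along the cycle to the layer
  \<open>t\<close>, then take two Kneser steps through a common neighbour.\<close>

lemma verts_connected:
  assumes n: "n > 0" and p: "p \<in> verts n"
    and one: "P (0, 1, 0)"
    and step: "\<And>p q. p \<in> verts n \<Longrightarrow> q \<in> verts n \<Longrightarrow> adj n p q \<Longrightarrow> P p \<Longrightarrow> P q"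
  shows "P p"
proof -
  have axis: "int k < n \<Longrightarrow> P (0, 1, int k)" for k
  proof (induction k)
    case 0
    then show ?case using one by simp
  next
    case (Suc k)
    show ?case
      by (rule step[of "(0, 1, int k)"]) (use Suc in \<open>auto simp: verts_def adj_def\<close>)
  qed
  obtain i j t where p': "p = (i, j, t)" and ij: "i \<in> {0..<7}" "j \<in> {0..<7}" "i \<noteq> j" "t \<in> {0..<n}"
    using p by (rule vertsE)
  obtain k l where kl: "k \<in> {0..<7}" "l \<in> {0..<7}" "k \<noteq> l" "{0, 1} \<inter> {k, l} = {}" "{k, l} \<inter> {i, j} = {}"
    by (rule common_neighbour)
  have "P (0, 1, t)" using axis[of "nat t"] ij by simp
  then have "P (k, l, t)"
    by (rule step[rotated 3]) (use ij kl in \<open>auto simp: verts_def adj_def\<close>)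
  then show ?thesis
    unfolding p' by (rule step[rotated 3]) (use ij kl in \<open>auto simp: verts_def adj_def\<close>)
qed

section \<open>Realization as a Cayley graph\<close>

text \<open>The connection set consists of the neighbours of the identity. It generates the group by
  the induction principle \<open>conn\<close>, applied to membership in the generated
  subgroup.\<close>

lemma (in group) cayley_graph_of_invariant_relation:
  assumes inv: "\<And>x y z. x \<in> carrier G \<Longrightarrow> y \<in> carrier G \<Longrightarrow> z \<in> carrier G \<Longrightarrow> R x y \<Longrightarrow> R (x \<otimes> z) (y \<otimes> z)"
    and sym: "\<And>x y. x \<in> carrier G \<Longrightarrow> y \<in> carrier G \<Longrightarrow> R x y \<Longrightarrow> R y x"
    and conn: "\<And>x P. x \<in> carrier G \<Longrightarrow> P \<one> \<Longrightarrow>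
      (\<And>y z. y \<in> carrier G \<Longrightarrow> z \<in> carrier G \<Longrightarrow> R y z \<Longrightarrow> P y \<Longrightarrow> P z) \<Longrightarrow> P x"
  shows "\<exists>E. cayley_graph G E \<and> (\<forall>x\<in>carrier G. \<forall>y\<in>carrier G. {x, y} \<in> E \<longleftrightarrow> R x y)"
proof -
  define S where "S = {s \<in> carrier G. R s \<one>}"
  have S: "S \<subseteq> carrier G" by (auto simp: S_def)
  have inv_S: "inv s \<in> S" if "s \<in> S" for s
    using inv[of s \<one> "inv s"] sym[of \<one> "inv s"] that by (simp add: S_def)
  have set_inv: "set_inv S = S"
  proof
    show "set_inv S \<subseteq> S" using inv_S by (auto simp: SET_INV_def)
    show "S \<subseteq> set_inv S"
    proof
      fix s assume s: "s \<in> S"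
      then have "s = inv (inv s)" using S by auto
      then show "s \<in> set_inv S" using inv_S[OF s] by (auto simp: SET_INV_def)
    qed
  qed
  \<comment> \<open>Translation by \<open>inv y\<close> moves the pair \<open>x\<close>,
    \<open>y\<close> to \<open>x \<otimes> inv y\<close> and the identity; translation by
    \<open>y\<close> moves it back.\<close>
  have R_iff: "x \<otimes> inv y \<in> S \<longleftrightarrow> R x y" if "x \<in> carrier G" "y \<in> carrier G" for x y
    using inv[of x y "inv y"] inv[of "x \<otimes> inv y" \<one> y] that by (auto simp: S_def m_assoc)
  have "x \<in> generate G S" if "x \<in> carrier G" for x
  proof (rule conn[OF that])
    show "\<one> \<in> generate G S" by (rule generate.one)
  next
    fix y z assume yz: "y \<in> carrier G" "z \<in> carrier G" "R y z" "y \<in> generate G S"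
    then have "z \<otimes> inv y \<in> generate G S"
      using R_iff sym by (intro generate.incl) auto
    then have "(z \<otimes> inv y) \<otimes> y \<in> generate G S"
      using yz(4) by (rule generate.eng)
    then show "z \<in> generate G S" using yz by (simp add: m_assoc)
  qed
  then have "generate G S = carrier G" using generate_in_carrier[OF S] by blast
  then have "cayley_graph G (cayley_edges G S)"
    using S set_inv by (auto simp: cayley_graph_def)
  then show ?thesis
    using cayley_edges_iff[OF S set_inv] R_iff by blast
qed

lemma affine_cycle_cayley_graph:
  assumes n: "n > 0"
  obtains G :: "nat monoid" and E and e :: "int \<times> int \<times> int \<Rightarrow> nat"
  where "group G" "cayley_graph G E" "bij_betw e (verts n) (carrier G)"
    "\<And>p q. p \<in> verts n \<Longrightarrow> q \<in> verts n \<Longrightarrow> {e p, e q} \<in> E \<longleftrightarrow> adj n p q"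
proof -
  \<comment> \<open>The vertices are coded by natural numbers, since the group is to live on
    \<open>nat\<close>.\<close>
  define G :: "nat monoid" where "G = \<lparr>carrier = to_nat ` verts n,
    monoid.mult = (\<lambda>x y. to_nat (vmult n (from_nat x) (from_nat y))), one = to_nat (0 :: int, 1 :: int, 0 :: int)\<rparr>"
  have "group G"
  proof (rule groupI)
    fix x assume "x \<in> carrier G"
    then obtain p where p: "p \<in> verts n" "x = to_nat p" by (auto simp: G_def)
    obtain q where "q \<in> verts n" "vmult n q p = (0, 1, 0)"
      using vmult_inverse[OF p(1) n] by blast
    then show "\<exists>y\<in>carrier G. y \<otimes>\<^bsub>G\<^esub> x = \<one>\<^bsub>G\<^esub>"
      by (intro bexI[of _ "to_nat q"]) (auto simp: G_def p(2))
  qed (use n in \<open>auto simp: G_def vmult_closed vmult_assoc vmult_one one_in_verts\<close>)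
  then interpret group G .
  define R where "R x y = adj n (from_nat x) (from_nat y)" for x y :: nat
  have "\<exists>E. cayley_graph G E \<and> (\<forall>x\<in>carrier G. \<forall>y\<in>carrier G. {x, y} \<in> E \<longleftrightarrow> R x y)"
  proof (rule cayley_graph_of_invariant_relation[of R])
    show "R (x \<otimes>\<^bsub>G\<^esub> z) (y \<otimes>\<^bsub>G\<^esub> z)"
      if "x \<in> carrier G" "y \<in> carrier G" "z \<in> carrier G" "R x y" for x y z
      using that adj_vmult[OF n] by (auto simp: G_def R_def)
    show "R y x" if "x \<in> carrier G" "y \<in> carrier G" "R x y" for x y
      using that adj_sym by (auto simp: G_def R_def)
  next
    fix x P
    assume x: "x \<in> carrier G" and one: "P \<one>\<^bsub>G\<^esub>"
      and step: "\<And>y z. y \<in> carrier G \<Longrightarrow> z \<in> carrier G \<Longrightarrow> R y z \<Longrightarrow> P y \<Longrightarrow> P z"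
    obtain p where p: "p \<in> verts n" "x = to_nat p" using x by (auto simp: G_def)
    have "P (to_nat p)"
    proof (rule verts_connected[OF n p(1), of "\<lambda>p. P (to_nat p)"])
      show "P (to_nat (0 :: int, 1 :: int, 0 :: int))" using one by (simp add: G_def)
      show "P (to_nat q)" if "p \<in> verts n" "q \<in> verts n" "adj n p q" "P (to_nat p)" for p q
        using step[of "to_nat p" "to_nat q"] that by (simp add: G_def R_def)
    qed
    then show "P x" by (simp add: p(2))
  qed
  then obtain E where "cayley_graph G E"
    "\<forall>x\<in>carrier G. \<forall>y\<in>carrier G. {x, y} \<in> E \<longleftrightarrow> R x y" by blast
  moreover have "bij_betw to_nat (verts n) (carrier G)"
    by (auto simp: G_def bij_betw_def inj_on_def)
  ultimately show thesis
    using that[of G E to_nat] \<open>group G\<close> by (auto simp: G_def R_def)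
qed

theorem theorem3:
  shows "\<exists>c::real. c > 0 \<and>
    (\<forall>N::nat. \<exists>(G :: nat monoid) E.
       group G \<and> finite (carrier G) \<and> card (carrier G) \<ge> N \<and>
       cayley_graph G E \<and>
       \<not> (\<exists>B. orthonormal_eigenbasis (carrier G) E B \<and>
              quantum_ergodic c (carrier G) B))"
proof (intro exI[of _ "1 / 10 ^ 6"] conjI allI)
  fix N :: nat
  \<comment> \<open>The summand 3 ensures \<open>n > 2\<close>, and \<open>42 * n\<close> vertices
    are at least \<open>N\<close>.\<close>
  define n where "n = int N + 3"
  have n: "n > 0" "n > 2" by (simp_all add: n_def)
  obtain G :: "nat monoid" and E e where G: "group G" "cayley_graph G E"
    and e: "bij_betw e (verts n) (carrier G)"
    and E: "\<And>p q. p \<in> verts n \<Longrightarrow> q \<in> verts n \<Longrightarrow> {e p, e q} \<in> E \<longleftrightarrow> adj n p q"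
    using affine_cycle_cayley_graph[OF n(1)] by metis
  have "finite (carrier G)" using e bij_betw_finite finite_verts by metis
  moreover have "card (carrier G) \<ge> N"
    using bij_betw_same_card[OF e] card_verts[of n] by (simp add: n_def)
  ultimately show "\<exists>(G :: nat monoid) E. group G \<and> finite (carrier G) \<and> card (carrier G) \<ge> N \<and>
       cayley_graph G E \<and>
       \<not> (\<exists>B. orthonormal_eigenbasis (carrier G) E B \<and>
              quantum_ergodic (1 / 10 ^ 6) (carrier G) B)"
    using G kneser_cycle_not_quantum_ergodic[OF n(2) e E] by blast
qed simp

end
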